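(* Let $\Phi:\mathcal{M}_{2D}\to\mathbb{R}^{d}$ be a random linear map such that for all sketchable SDPs there exists an algorithm which allows us to estimate the value of an SDP up to a constant factor $1\le\tau<\frac{2}{\sqrt{3}}$ given the sketch $\{\Phi(A),\Phi(B_1),\ldots,\Phi(B_m)\}$ with probability at least $9/10$. Then $d=\Omega(D^2)$.
   Context: $\mathcal{M}_n$ is the set of real $n\times n$ matrices and $\mathcal{M}_n^{\mathrm{sym}}$ the subset of symmetric matrices. Given $A,B_1,\ldots,B_m\in\mathcal{M}_{n}^{\mathrm{sym}}$ and $\gamma_1,\ldots,\gamma_m\in\mathbb{R}$, the constrained optimization problem: maximize $\operatorname{Tr}(AX)$ subject to $\operatorname{Tr}(B_iX)\le\gamma_i$ for $i=1,\ldots,m$ and $X\ge 0$ (that is, $X$ is a symmetric positive semidefinite $n\times n$ matrix) is called a sketchable SDP (semidefinite program). Its value is the optimal value of this problem. In the claim the matrices $A,B_1,\ldots,B_m$ defining the SDP have size $n=2D$, so that $\Phi$ can be applied to them. A random linear map is a random variable taking values in the linear maps $\mathcal{M}_{2D}\to\mathbb{R}^d$; $d$ is the dimension of the sketch. $d=\Omega(D^2)$ is the usual asymptotic notation: $d$ is bounded below by a positive constant times $D^2$ for large $D$. *)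

theory Defs
  imports "HOL-Probability.Probability" "Jordan_Normal_Form.Matrix"
begin

type_synonym rmat = "real Matrix.mat"
type_synonym rvec = "real Matrix.vec"

definition mat_trace :: "rmat \<Rightarrow> real" where
  "mat_trace X = (\<Sum>i<dim_row X. X $$ (i, i))"

definition sym_mats :: "nat \<Rightarrow> rmat set" where
  "sym_mats n = {A \<in> carrier_mat n n. transpose_mat A = A}"

definition psd_mats :: "nat \<Rightarrow> rmat set" where
  "psd_mats n = {X \<in> sym_mats n. \<forall>v\<in>carrier_vec n. 0 \<le> scalar_prod v (X *\<^sub>v v)}"

text \<open>The sketchable SDP with data \<open>A\<close>, \<open>B i\<close>, \<open>\<gamma> i\<close> for \<open>i < m\<close>. Its value is an extended
  real: \<open>-\<infinity>\<close> if no \<open>X\<close> is feasible, \<open>\<infinity>\<close> if the objective is unbounded above.\<close>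

definition sdp_feasible :: "nat \<Rightarrow> nat \<Rightarrow> (nat \<Rightarrow> rmat) \<Rightarrow> (nat \<Rightarrow> real) \<Rightarrow> rmat set" where
  "sdp_feasible n m B \<gamma> = {X \<in> psd_mats n. \<forall>i<m. mat_trace (B i * X) \<le> \<gamma> i}"

definition sdp_value ::
  "nat \<Rightarrow> nat \<Rightarrow> rmat \<Rightarrow> (nat \<Rightarrow> rmat) \<Rightarrow> (nat \<Rightarrow> real) \<Rightarrow> ereal" where
  "sdp_value n m A B \<gamma> = (SUP X\<in>sdp_feasible n m B \<gamma>. ereal (mat_trace (A * X)))"

definition linear_mat_map :: "nat \<Rightarrow> nat \<Rightarrow> (rmat \<Rightarrow> rvec) \<Rightarrow> bool" where
  "linear_mat_map n d L \<longleftrightarrow>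
     L \<in> carrier_mat n n \<rightarrow> carrier_vec d \<and>
     (\<forall>X\<in>carrier_mat n n. \<forall>Y\<in>carrier_mat n n. L (X + Y) = L X + L Y) \<and>
     (\<forall>c. \<forall>X\<in>carrier_mat n n. L (c \<cdot>\<^sub>m X) = c \<cdot>\<^sub>v L X)"

text \<open>The Borel sigma-algebra of \<open>\<real>\<^sup>d\<close>, carried over to \<open>carrier_vec d\<close> along coordinates.\<close>

definition borel_vec :: "nat \<Rightarrow> rvec measure" where
  "borel_vec d = vimage_algebra (carrier_vec d) (\<lambda>v. \<lambda>i\<in>{..<d}. vec_index v i)
     (\<Pi>\<^sub>M i\<in>{..<d}. (borel :: real measure))"

text \<open>On the finite-dimensional space of linear maps, measurability of a random map is
  measurability of all its evaluations.\<close>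

definition random_linear_map ::
  "'w measure \<Rightarrow> nat \<Rightarrow> nat \<Rightarrow> ('w \<Rightarrow> rmat \<Rightarrow> rvec) \<Rightarrow> bool" where
  "random_linear_map M n d \<Phi> \<longleftrightarrow>
     prob_space M \<and>
     (\<forall>\<omega>\<in>space M. linear_mat_map n d (\<Phi> \<omega>)) \<and>
     (\<forall>X\<in>carrier_mat n n. (\<lambda>\<omega>. \<Phi> \<omega> X) \<in> M \<rightarrow>\<^sub>M borel_vec d)"

text \<open>\<open>x\<close> estimates \<open>v\<close> up to the factor \<open>\<tau>\<close> in either direction; for \<open>v \<ge> 0\<close> this is
  \<open>v / \<tau> \<le> x \<le> \<tau> * v\<close>, and for \<open>v \<le> 0\<close> the two bounds are exchanged.\<close>

definition within_factor :: "real \<Rightarrow> real \<Rightarrow> real \<Rightarrow> bool" where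
  "within_factor \<tau> v x \<longleftrightarrow> (\<exists>s. 1 / \<tau> \<le> s \<and> s \<le> \<tau> \<and> x = s * v)"

text \<open>An algorithm is a measurable function of the bounds \<open>\<gamma>\<close> and of the sketches of \<open>A\<close> and of
  the \<open>B i\<close>, one for each number \<open>m\<close> of constraints and the same for all SDPs with \<open>m\<close>
  constraints: if it were chosen after the SDP, it could return the value without looking at the
  sketch. It also receives the sample point \<open>\<omega>\<close>, so that it may know the map \<open>\<Phi> \<omega>\<close> that was
  drawn and may be randomised itself, its coin tosses being part of the sample space.
  The SDP is fixed before \<open>\<omega>\<close> is drawn, so \<open>9/10\<close> bounds the success probability separately for
  each SDP. An estimate is required only where the SDP has a (finite) optimal value.\<close>

definition sketch_estimates_sdps ::
  "'w measure \<Rightarrow> nat \<Rightarrow> nat \<Rightarrow> ('w \<Rightarrow> rmat \<Rightarrow> rvec) \<Rightarrow> real \<Rightarrow> bool" where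
  "sketch_estimates_sdps M n d \<Phi> \<tau> \<longleftrightarrow>
     (\<exists>alg :: nat \<Rightarrow> 'w \<times> (nat \<Rightarrow> real) \<times> rvec \<times> (nat \<Rightarrow> rvec) \<Rightarrow> real. \<forall>m.
        alg m \<in> M \<Otimes>\<^sub>M (\<Pi>\<^sub>M i\<in>{..<m}. borel) \<Otimes>\<^sub>M borel_vec d \<Otimes>\<^sub>M (\<Pi>\<^sub>M i\<in>{..<m}. borel_vec d)
                  \<rightarrow>\<^sub>M borel \<and>
        (\<forall>A B \<gamma> v.
           A \<in> sym_mats n \<longrightarrow> (\<forall>i<m. B i \<in> sym_mats n) \<longrightarrow> sdp_value n m A B \<gamma> = ereal v \<longrightarrow>
           measure M {\<omega> \<in> space M. within_factor \<tau> v
             (alg m (\<omega>, (\<lambda>i\<in>{..<m}. \<gamma> i), \<Phi> \<omega> A, (\<lambda>i\<in>{..<m}. \<Phi> \<omega> (B i))))} \<ge> 9 / 10))"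

end

theory Submission
  imports Defs
begin

text \<open>An estimate up to a factor reveals exactly whether the value is \<open>0\<close>. For a symmetric \<open>A\<close>
  supported on off-diagonal positions \<open>I\<close>, the constraints \<open>X\<^sub>k\<^sub>k \<le> \<gamma>\<^sub>k\<close> with \<open>\<gamma>\<^sub>k = 1\<close> for \<open>k \<in> {i, j}\<close>
  and \<open>\<gamma>\<^sub>k = 0\<close> otherwise give an SDP of value \<open>2 * \<bar>A\<^sub>i\<^sub>j\<bar>\<close>, so the sketch of \<open>A\<close> must reveal, for each
  position in \<open>I\<close>, whether that entry vanishes. Fix a position \<open>p\<close> and draw the other entries of \<open>A\<close>
  uniformly from \<open>[0, 1]\<close>. If the sketch of the unit matrix at \<open>p\<close> lies in the span of the sketches
  of the other unit matrices, then changing \<open>A\<^sub>p\<close> from \<open>0\<close> to \<open>t\<close> has the same effect on the sketch as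
  a translation of the other entries by \<open>O(t)\<close>, which hardly changes the uniform distribution. So for
  \<open>t \<rightarrow> 0\<close> the two cases become indistinguishable. At most \<open>d\<close> positions are not of this kind, whatever
  map was drawn; averaging over the map gives \<open>4/5 * card I \<le> d\<close>.\<close>

section \<open>Linear algebra: how many columns can lie outside the span of the others\<close>

text \<open>Gaussian elimination on the last equation: each equation uses up at most one unknown as
  pivot, so with more unknowns than equations one stays free.\<close>

lemma homogeneous_system_nontrivial:
  fixes c :: "nat \<Rightarrow> 'i \<Rightarrow> 'a::field"
  assumes "finite P" "d < card P"
  shows "\<exists>s. (\<exists>p\<in>P. s p \<noteq> 0) \<and> (\<forall>r<d. (\<Sum>q\<in>P. s q * c r q) = 0)"
  using assms
proof (induction d arbitrary: P c)
  case 0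
  then obtain p where "p \<in> P" by fastforce
  then show ?case by (intro exI[of _ "\<lambda>_. 1"]) auto
next
  case (Suc d)
  show ?case
  proof (cases "\<forall>q\<in>P. c d q = 0")
    case True
    from Suc.IH[OF Suc.prems(1), of c] Suc.prems(2)
    obtain s where "\<exists>p\<in>P. s p \<noteq> 0" "\<forall>r<d. (\<Sum>q\<in>P. s q * c r q) = 0" by auto
    with True show ?thesis by (intro exI[of _ s]) (auto simp: less_Suc_eq)
  next
    case False
    then obtain p where p: "p \<in> P" "c d p \<noteq> 0" by auto
    \<comment> \<open>Row \<open>r\<close> minus the multiple of row \<open>d\<close> that clears
      the pivot column \<open>p\<close>; row \<open>d\<close> itself becomes zero.\<close>
    define e where "e = (\<lambda>r q. c r q - c r p * c d q / c d p)"
    have "d < card (P - {p})" using Suc.prems p(1) by simp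
    from Suc.IH[OF finite_Diff[OF Suc.prems(1)] this, of e]
    obtain s where s: "\<exists>q\<in>P-{p}. s q \<noteq> 0" "\<And>r. r < d \<Longrightarrow> (\<Sum>q\<in>P-{p}. s q * e r q) = 0"
      by blast
    \<comment> \<open>The value at \<open>p\<close> is the one that solves equation
      \<open>d\<close>; the reduced system takes care of the other equations.\<close>
    define t where "t = s(p := - (\<Sum>q\<in>P-{p}. s q * c d q) / c d p)"
    have t: "(\<Sum>q\<in>P. t q * c r q) = (\<Sum>q\<in>P-{p}. s q * e r q)" for r
    proof -
      have "(\<Sum>q\<in>P. t q * c r q) = t p * c r p + (\<Sum>q\<in>P-{p}. t q * c r q)"
        using Suc.prems(1) p(1) by (simp add: sum.remove)
      also have "(\<Sum>q\<in>P-{p}. t q * c r q) = (\<Sum>q\<in>P-{p}. s q * c r q)"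
        by (intro sum.cong) (auto simp: t_def)
      also have "t p * c r p = - (\<Sum>q\<in>P-{p}. s q * (c r p * c d q / c d p))"
      proof -
        have "(\<Sum>q\<in>P-{p}. s q * (c r p * c d q / c d p)) = (\<Sum>q\<in>P-{p}. s q * c d q) * (c r p / c d p)"
          unfolding sum_distrib_right by (intro sum.cong) auto
        then show ?thesis by (simp add: t_def)
      qed
      finally show ?thesis by (simp add: e_def right_diff_distrib sum_subtractf)
    qed
    have "e d q = 0" for q using p by (simp add: e_def)
    then have "\<forall>r<Suc d. (\<Sum>q\<in>P. t q * c r q) = 0"
      using s(2) by (auto simp: t less_Suc_eq)
    moreover have "\<exists>q\<in>P. t q \<noteq> 0" using s(1) by (auto simp: t_def)
    ultimately show ?thesis by blast
  qed
qed

text \<open>More than \<open>d\<close> such columns would satisfy a nontrivial relation among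
  themselves. Solving it for a column with nonzero coefficient puts that column in the span of the
  others.\<close>

lemma card_columns_not_in_span:
  fixes c :: "nat \<Rightarrow> 'i \<Rightarrow> 'a::field"
  assumes "finite I"
  shows "card {p \<in> I. \<not> (\<exists>a. \<forall>r<d. c r p = (\<Sum>q\<in>I-{p}. a q * c r q))} \<le> d"
proof (rule ccontr)
  define P where "P = {p \<in> I. \<not> (\<exists>a. \<forall>r<d. c r p = (\<Sum>q\<in>I-{p}. a q * c r q))}"
  assume "\<not> ?thesis"
  then have "d < card P" by (simp add: P_def)
  moreover have fin: "finite P" using assms by (simp add: P_def)
  ultimately obtain s p where s: "p \<in> P" "s p \<noteq> 0" "\<And>r. r < d \<Longrightarrow> (\<Sum>q\<in>P. s q * c r q) = 0"
    using homogeneous_system_nontrivial[of P d c] by blast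
  \<comment> \<open>The relation solved for column \<open>p\<close>, with coefficient 0 on the rest
    of \<open>I\<close>.\<close>
  define a where "a = (\<lambda>q. if q \<in> P then - s q / s p else 0)"
  have "c r p = (\<Sum>q\<in>I-{p}. a q * c r q)" if "r < d" for r
  proof -
    have "(\<Sum>q\<in>I-{p}. a q * c r q) = (\<Sum>q\<in>P-{p}. a q * c r q)"
      using assms by (intro sum.mono_neutral_right) (auto simp: a_def P_def)
    also have "\<dots> = - (\<Sum>q\<in>P-{p}. s q * c r q) / s p"
      by (simp add: a_def sum_divide_distrib flip: sum_negf)
    also have "(\<Sum>q\<in>P-{p}. s q * c r q) = - s p * c r p"
      using s(3)[OF that] sum.remove[OF fin s(1), of "\<lambda>q. s q * c r q"]
      by (simp add: eq_neg_iff_add_eq_0 add.commute)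
    finally show ?thesis using s(2) by simp
  qed
  with s(1) show False by (auto simp: P_def)
qed

section \<open>Uniform distributions on cubes under translation\<close>

abbreviation unif01 :: "real measure" where
  "unif01 \<equiv> uniform_measure lborel {0..1}"

lemma prob_space_unif01: "prob_space unif01"
  by (intro prob_space_uniform_measure) auto

lemma integral_unif01:
  fixes f :: "real \<Rightarrow> real"
  assumes "f \<in> borel_measurable borel"
  shows "(\<integral>x. f x \<partial>unif01) = (\<integral>x. indicator {0..1} x * f x \<partial>lborel)"
proof -
  have "unif01 = density lborel (\<lambda>x. ennreal (indicator {0..1} x))"
    unfolding uniform_measure_def by (simp add: ennreal_indicator divide_ennreal_def)
  then show ?thesis using assms by (simp add: integral_density)
qed

text \<open>A total variation estimate: the unit interval and its translate differ only inside the
  interval between 0 and \<open>s\<close> and the translate of that interval by 1, each of length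
  \<open>\<bar>s\<bar>\<close>.\<close>

lemma unif01_shift:
  fixes f :: "real \<Rightarrow> real"
  assumes f_meas [measurable]: "f \<in> borel_measurable borel"
    and f: "\<And>x. 0 \<le> f x" "\<And>x. f x \<le> 1"
  shows "\<bar>(\<integral>x. f (x + s) \<partial>unif01) - (\<integral>x. f x \<partial>unif01)\<bar> \<le> 2 * \<bar>s\<bar>"
proof -
  have int: "integrable lborel (\<lambda>x. indicator {a..b} x * f x)" for a b
    by (rule integrableI_bounded_set[where A = "{a..b}" and B = 1])
       (use f in \<open>auto simp: indicator_def emeasure_lborel_Icc_eq less_top[symmetric]\<close>)
  have int1: "integrable lborel (indicator {a..b} :: real \<Rightarrow> real)" for a b :: real
    by (rule integrable_real_indicator) (auto simp: emeasure_lborel_Icc_eq less_top[symmetric])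
  define l u where "l = min 0 s" and "u = max 0 s"
  have "(\<integral>x. f (x + s) \<partial>unif01) = (\<integral>x. indicator {0..1} x * f (x + s) \<partial>lborel)"
    by (rule integral_unif01) measurable
  \<comment> \<open>The integrand is written in terms of \<open>s + 1 * x\<close> to fit the affine
    substitution rule for \<open>lborel\<close>.\<close>
  also have "\<dots> = (\<integral>x. indicator {s..1+s} (s + 1 * x) * f (s + 1 * x) \<partial>lborel)"
    by (intro Bochner_Integration.integral_cong) (auto simp: indicator_def add.commute)
  also have "\<dots> = (\<integral>x. indicator {s..1+s} x * f x \<partial>lborel)"
    by (subst lborel_integral_real_affine[of 1 _ s]) auto
  finally have "(\<integral>x. f (x + s) \<partial>unif01) - (\<integral>x. f x \<partial>unif01) =
      (\<integral>x. indicator {s..1+s} x * f x - indicator {0..1} x * f x \<partial>lborel)"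
    by (simp add: integral_unif01 int)
  also have "\<bar>\<dots>\<bar> \<le> (\<integral>x. \<bar>indicator {s..1+s} x * f x - indicator {0..1} x * f x\<bar> \<partial>lborel)"
    by (rule integral_abs_bound)
  also have "\<dots> \<le> (\<integral>x. indicator {l..u} x + indicator {1+l..1+u} x \<partial>lborel)"
  proof (intro integral_mono integrable_abs Bochner_Integration.integrable_diff
        Bochner_Integration.integrable_add int int1)
    show "\<bar>indicator {s..1+s} x * f x - indicator {0..1} x * f x\<bar> \<le>
        indicator {l..u} x + indicator {1+l..1+u} x" for x
      using f(1)[of x] f(2)[of x] by (auto simp: l_def u_def indicator_def)
  qed
  also have "\<dots> = 2 * \<bar>s\<bar>"
    by (subst Bochner_Integration.integral_add) (auto simp: int1 l_def u_def)
  finally show ?thesis .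
qed

interpretation unif01: product_sigma_finite "\<lambda>_. unif01"
  by (simp add: product_sigma_finite_def prob_space_unif01 prob_space_imp_sigma_finite)

lemma sets_PiM_unif01 [measurable_cong]: "sets (PiM J (\<lambda>_. unif01)) = sets (PiM J (\<lambda>_. borel))"
  by (intro sets_PiM_cong) auto

text \<open>Hybrid argument: coordinates are shifted one at a time, each at cost
  \<open>2 * \<bar>a q\<bar>\<close>, and the costs add up by the triangle inequality.\<close>

lemma cube_shift:
  fixes f :: "('i \<Rightarrow> real) \<Rightarrow> real"
  assumes "finite J" "f \<in> borel_measurable (PiM J (\<lambda>_. borel))"
    and "\<And>x. 0 \<le> f x" "\<And>x. f x \<le> 1"
  shows "\<bar>(\<integral>x. f (\<lambda>q\<in>J. x q + a q) \<partial>PiM J (\<lambda>_. unif01)) - (\<integral>x. f x \<partial>PiM J (\<lambda>_. unif01))\<bar>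
    \<le> 2 * (\<Sum>q\<in>J. \<bar>a q\<bar>)"
  using assms
proof (induction J arbitrary: f)
  case empty
  have "(\<integral>x. f (\<lambda>q\<in>{}. x q + a q) \<partial>PiM {} (\<lambda>_. unif01)) = (\<integral>x. f x \<partial>PiM {} (\<lambda>_. unif01))"
    by (intro Bochner_Integration.integral_cong) (auto simp: space_PiM restrict_def)
  then show ?case by (simp only: sum.empty diff_self abs_zero mult_zero_right order_refl)
next
  case (insert p J)
  note f_meas [measurable] = insert.prems(1)
  let ?Q = "PiM J (\<lambda>_. unif01)" and ?Q' = "PiM (insert p J) (\<lambda>_. unif01)"
  let ?sh = "\<lambda>K x. \<lambda>q\<in>K. x q + a q"
  interpret Q: prob_space ?Q by (rule prob_space_PiM) (rule prob_space_unif01)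
  interpret Q': prob_space ?Q' by (rule prob_space_PiM) (rule prob_space_unif01)
  interpret U: prob_space unif01 by (rule prob_space_unif01)
  have sh_meas [measurable]: "?sh K \<in> PiM K (\<lambda>_. borel) \<rightarrow>\<^sub>M PiM K (\<lambda>_. borel)" for K
    by measurable
  have up [measurable]: "(\<lambda>(x, y). x(p := y)) \<in> PiM J (\<lambda>_. borel) \<Otimes>\<^sub>M borel \<rightarrow>\<^sub>M PiM (insert p J) (\<lambda>_. borel)"
    using measurable_add_dim[of p J "\<lambda>_. borel :: real measure"] by simp
  \<comment> \<open>Integrating out the unshifted coordinate \<open>p\<close> leaves a measurable
    function with values in [0, 1], to which the induction hypothesis applies.\<close>
  define h where "h x = (\<integral>y. f (x(p := y)) \<partial>unif01)" for x
  have h_meas [measurable]: "h \<in> borel_measurable (PiM J (\<lambda>_. borel))"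
    unfolding h_def by measurable
  have bnd: "norm (f z) \<le> 1" for z using insert.prems(2,3)[of z] by simp
  have one: "(\<lambda>y. f (x(p := y))) \<in> borel_measurable borel" if "x \<in> space (PiM J (\<lambda>_. borel))" for x
    using that by measurable
  have h0: "0 \<le> h x" for x unfolding h_def using insert.prems(2) by simp
  have h1: "h x \<le> 1" for x
  proof -
    have "h x \<le> (\<integral>y. 1 \<partial>unif01)" unfolding h_def
      by (rule integral_mono') (use insert.prems in auto)
    then show ?thesis by (simp add: U.prob_space)
  qed
  have i1: "integrable ?Q' f"
    by (rule Q'.integrable_const_bound[where B = 1]) (use bnd in auto)
  have i2: "integrable ?Q' (\<lambda>x. f (?sh (insert p J) x))"
    by (rule Q'.integrable_const_bound[where B = 1]) (use bnd in auto)
  have sh_upd: "?sh (insert p J) (x(p := y)) = (?sh J x)(p := y + a p)" for x y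
    using insert.hyps(2) by (auto simp: fun_eq_iff)
  have e1: "(\<integral>x. f x \<partial>?Q') = (\<integral>x. h x \<partial>?Q)"
    unfolding h_def using unif01.product_integral_insert[OF insert.hyps(1,2) i1] .
  have e2: "(\<integral>x. f (?sh (insert p J) x) \<partial>?Q') = (\<integral>x. (\<integral>y. f ((?sh J x)(p := y + a p)) \<partial>unif01) \<partial>?Q)"
    using unif01.product_integral_insert[OF insert.hyps(1,2) i2] by (simp only: sh_upd)
  have i3: "integrable ?Q (\<lambda>x. h (?sh J x))"
    by (rule Q.integrable_const_bound[where B = 1]) (use h0 h1 in auto)
  \<comment> \<open>In \<open>g\<close> all coordinates are shifted; the intermediate hybrid
    \<open>h (?sh J x)\<close> leaves coordinate \<open>p\<close> unshifted.\<close>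
  define g where "g x = (\<integral>y. f ((?sh J x)(p := y + a p)) \<partial>unif01)" for x
  have g_meas [measurable]: "g \<in> borel_measurable (PiM J (\<lambda>_. borel))"
    unfolding g_def by measurable
  have gh: "\<bar>g x - h (?sh J x)\<bar> \<le> 2 * \<bar>a p\<bar>" if "x \<in> space ?Q" for x
  proof -
    have "?sh J x \<in> space (PiM J (\<lambda>_. borel))" by (auto simp: space_PiM)
    from unif01_shift[OF one[OF this], of "a p"] insert.prems(2,3)
    show ?thesis unfolding g_def h_def by simp
  qed
  have i4: "integrable ?Q g"
  proof (rule Q.integrable_const_bound[where B = "1 + 2 * \<bar>a p\<bar>"])
    show "AE x in ?Q. norm (g x) \<le> 1 + 2 * \<bar>a p\<bar>"
    proof (rule AE_I2)
      fix x assume "x \<in> space ?Q"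
      from gh[OF this] h0[of "?sh J x"] h1[of "?sh J x"]
      show "norm (g x) \<le> 1 + 2 * \<bar>a p\<bar>" by auto
    qed
  qed measurable
  have "\<bar>(\<integral>x. g x \<partial>?Q) - (\<integral>x. h (?sh J x) \<partial>?Q)\<bar> = \<bar>\<integral>x. g x - h (?sh J x) \<partial>?Q\<bar>"
    using i3 i4 by simp
  also have "\<dots> \<le> (\<integral>x. \<bar>g x - h (?sh J x)\<bar> \<partial>?Q)" by (rule integral_abs_bound)
  also have "\<dots> \<le> (\<integral>x. 2 * \<bar>a p\<bar> \<partial>?Q)"
    by (rule integral_mono) (use i3 i4 gh in auto)
  also have "\<dots> = 2 * \<bar>a p\<bar>" by (simp add: Q.prob_space)
  finally have "\<bar>(\<integral>x. g x \<partial>?Q) - (\<integral>x. h (?sh J x) \<partial>?Q)\<bar> \<le> 2 * \<bar>a p\<bar>" .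
  moreover have "\<bar>(\<integral>x. h (?sh J x) \<partial>?Q) - (\<integral>x. h x \<partial>?Q)\<bar> \<le> 2 * (\<Sum>q\<in>J. \<bar>a q\<bar>)"
    by (rule insert.IH) (use h0 h1 in auto)
  ultimately show ?case
    using insert.hyps unfolding e1 e2 by (simp add: g_def)
qed

section \<open>Dimension bound from tests for vanishing entries\<close>

text \<open>Here \<open>f p\<close> is a test, applied to the sketch with matrix \<open>c \<omega>\<close> of an unknown \<open>x\<close>, for whether
  \<open>x p = 0\<close>; it accepts with probability at least \<open>\<alpha>\<close> if so and at most \<open>\<beta>\<close> if \<open>x p > 0\<close>.\<close>

lemma distinguishing_dimension_bound:
  fixes M :: "'w measure" and I :: "'i set" and c :: "'w \<Rightarrow> nat \<Rightarrow> 'i \<Rightarrow> real"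
    and f :: "'i \<Rightarrow> 'w \<times> (nat \<Rightarrow> real) \<Rightarrow> real" and \<alpha> \<beta> :: real
  assumes "prob_space M" and fin: "finite I"
    and c_meas [measurable]: "\<And>r q. r < d \<Longrightarrow> q \<in> I \<Longrightarrow> (\<lambda>\<omega>. c \<omega> r q) \<in> borel_measurable M"
    and f_meas: "\<And>p. p \<in> I \<Longrightarrow> f p \<in> borel_measurable (M \<Otimes>\<^sub>M PiM {..<d} (\<lambda>_. borel))"
    and f: "\<And>p z. 0 \<le> f p z" "\<And>p z. f p z \<le> 1"
    and zero: "\<And>p x. p \<in> I \<Longrightarrow> x p = 0 \<Longrightarrow> \<alpha> \<le> (\<integral>\<omega>. f p (\<omega>, \<lambda>r\<in>{..<d}. \<Sum>q\<in>I. x q * c \<omega> r q) \<partial>M)"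
    and pos: "\<And>p x. p \<in> I \<Longrightarrow> 0 < x p \<Longrightarrow> (\<integral>\<omega>. f p (\<omega>, \<lambda>r\<in>{..<d}. \<Sum>q\<in>I. x q * c \<omega> r q) \<partial>M) \<le> \<beta>"
  shows "(\<alpha> - \<beta>) * card I \<le> d"
proof -
  interpret M: prob_space M by fact
  define Q where "Q p = PiM (I - {p}) (\<lambda>_. unif01)" for p
  \<comment> \<open>\<open>S p t \<omega> x\<close> is the sketch of \<open>x\<close> after entry
    \<open>p\<close> is set to \<open>t\<close>; \<open>F p t \<omega>\<close> keeps the drawn map
    fixed and averages the test over uniform other entries.\<close>
  define S where "S p t \<omega> x = (\<lambda>r\<in>{..<d}. t * c \<omega> r p + (\<Sum>q\<in>I-{p}. x q * c \<omega> r q))" for p t \<omega> x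
  define F where "F p t \<omega> = (\<integral>x. f p (\<omega>, S p t \<omega> x) \<partial>Q p)" for p t \<omega>
  have sets_Q [measurable_cong]: "sets (Q p) = sets (PiM (I - {p}) (\<lambda>_. borel))" for p
    unfolding Q_def by (rule sets_PiM_unif01)
  have Q_prob: "prob_space (Q p)" for p
    unfolding Q_def by (rule prob_space_PiM) (rule prob_space_unif01)
  have S_eq: "S p t \<omega> x = (\<lambda>r\<in>{..<d}. \<Sum>q\<in>I. (x(p := t)) q * c \<omega> r q)" if "p \<in> I" for p t \<omega> x
  proof -
    have "(\<Sum>q\<in>I. (x(p := t)) q * c \<omega> r q) = t * c \<omega> r p + (\<Sum>q\<in>I-{p}. x q * c \<omega> r q)" for r
      unfolding sum.remove[OF fin that] by (auto intro: sum.cong)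
    then show ?thesis by (simp add: S_def)
  qed
  have S_meas: "(\<lambda>(\<omega>, x). S p t \<omega> x) \<in> M \<Otimes>\<^sub>M Q p \<rightarrow>\<^sub>M PiM {..<d} (\<lambda>_. borel)" if [simp]: "p \<in> I" for p t
    unfolding S_def case_prod_beta
    by (rule measurable_restrict) (auto intro!: borel_measurable_add borel_measurable_sum borel_measurable_times)
  have fS_meas: "(\<lambda>(\<omega>, x). f p (\<omega>, S p t \<omega> x)) \<in> borel_measurable (M \<Otimes>\<^sub>M Q p)" if "p \<in> I" for p t
    using measurable_compose[OF measurable_Pair[OF measurable_fst S_meas[OF that, of t]] f_meas[OF that]]
    by (simp add: case_prod_beta)
  have F_meas [measurable]: "F p t \<in> borel_measurable M" if "p \<in> I" for p t
  proof -
    interpret Q: prob_space "Q p" by (rule Q_prob)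
    show ?thesis unfolding F_def
      by (rule Q.borel_measurable_lebesgue_integral) (rule fS_meas[OF that])
  qed
  have F01: "0 \<le> F p t \<omega>" "F p t \<omega> \<le> 1" for p t \<omega>
  proof -
    interpret Q: prob_space "Q p" by (rule Q_prob)
    show "0 \<le> F p t \<omega>" unfolding F_def using f by simp
    have "F p t \<omega> \<le> (\<integral>x. 1 \<partial>Q p)" unfolding F_def
      by (rule integral_mono') (use f in auto)
    then show "F p t \<omega> \<le> 1" by (simp add: Q.prob_space)
  qed
  have F_int: "integrable M (F p t)" if "p \<in> I" for p t
    by (rule M.integrable_const_bound[where B = 1]) (use F01 that in auto)
  \<comment> \<open>Fubini links two views: \<open>zero\<close> and \<open>pos\<close> fix
    \<open>x\<close> and average over \<open>\<omega>\<close>, while the translation argument fixes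
    \<open>\<omega>\<close> and averages over \<open>x\<close>.\<close>
  have swap: "(\<integral>\<omega>. F p t \<omega> \<partial>M) = (\<integral>x. (\<integral>\<omega>. f p (\<omega>, S p t \<omega> x) \<partial>M) \<partial>Q p)"
    and swap_int: "integrable (Q p) (\<lambda>x. \<integral>\<omega>. f p (\<omega>, S p t \<omega> x) \<partial>M)" if "p \<in> I" for p t
  proof -
    interpret Q: prob_space "Q p" by (rule Q_prob)
    interpret MQ: pair_prob_space M "Q p" ..
    have int: "integrable (M \<Otimes>\<^sub>M Q p) (\<lambda>(\<omega>, x). f p (\<omega>, S p t \<omega> x))"
      by (rule MQ.integrable_const_bound[where B = 1]) (use f fS_meas[OF that] in auto)
    show "(\<integral>\<omega>. F p t \<omega> \<partial>M) = (\<integral>x. (\<integral>\<omega>. f p (\<omega>, S p t \<omega> x) \<partial>M) \<partial>Q p)"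
      unfolding F_def using MQ.Fubini_integral[OF int] by simp
    show "integrable (Q p) (\<lambda>x. \<integral>\<omega>. f p (\<omega>, S p t \<omega> x) \<partial>M)"
      using MQ.integrable_snd[OF int] by simp
  qed
  have F0: "\<alpha> \<le> (\<integral>\<omega>. F p 0 \<omega> \<partial>M)" if "p \<in> I" for p
  proof -
    interpret Q: prob_space "Q p" by (rule Q_prob)
    have "(\<integral>x. \<alpha> \<partial>Q p) \<le> (\<integral>x. (\<integral>\<omega>. f p (\<omega>, S p 0 \<omega> x) \<partial>M) \<partial>Q p)"
      by (rule integral_mono) (use swap_int[OF that] zero[OF that] in \<open>auto simp: S_eq[OF that]\<close>)
    then show ?thesis by (simp add: swap[OF that] Q.prob_space)
  qed
  have Ft: "(\<integral>\<omega>. F p t \<omega> \<partial>M) \<le> \<beta>" if "p \<in> I" "0 < t" for p t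
  proof -
    interpret Q: prob_space "Q p" by (rule Q_prob)
    have "(\<integral>x. (\<integral>\<omega>. f p (\<omega>, S p t \<omega> x) \<partial>M) \<partial>Q p) \<le> (\<integral>x. \<beta> \<partial>Q p)"
      by (rule integral_mono)
         (use swap_int[OF that(1)] pos[OF that(1)] that(2) in \<open>auto simp: S_eq[OF that(1)]\<close>)
    then show ?thesis by (simp add: swap[OF that(1)] Q.prob_space)
  qed
  \<comment> \<open>The entry \<open>inverse (real (Suc k))\<close> is positive, so that
    \<open>pos\<close> applies, and tends to 0.\<close>
  define u where "u k p \<omega> = F p 0 \<omega> - F p (inverse (real (Suc k))) \<omega>" for k p \<omega>
  have u1: "u k p \<omega> \<le> 1" "- 1 \<le> u k p \<omega>" for k p \<omega>
    using F01[of p 0 \<omega>] F01[of p "inverse (real (Suc k))" \<omega>] unfolding u_def by auto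
  have u_lim: "(\<lambda>k. u k p \<omega>) \<longlonglongrightarrow> 0"
    if p: "p \<in> I" and \<omega>: "\<omega> \<in> space M" and a: "\<And>r. r < d \<Longrightarrow> c \<omega> r p = (\<Sum>q\<in>I-{p}. a q * c \<omega> r q)"
    for p \<omega> a
  proof (rule tendsto_rabs_zero_cancel, rule Lim_null_comparison)
    \<comment> \<open>This constant depends on \<open>\<omega>\<close> through \<open>a\<close>, so
      the convergence obtained is only pointwise; dominated convergence is used below.\<close>
    define A where "A = 2 * (\<Sum>q\<in>I-{p}. \<bar>a q\<bar>)"
    have shift: "S p t \<omega> x = S p 0 \<omega> (\<lambda>q\<in>I-{p}. x q + t * a q)" for t x
      unfolding S_def
    proof (intro restrict_ext)
      fix r assume "r \<in> {..<d}"
      then have "t * c \<omega> r p = (\<Sum>q\<in>I-{p}. t * a q * c \<omega> r q)"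
        using a[of r] by (simp add: sum_distrib_left mult.assoc)
      then show "t * c \<omega> r p + (\<Sum>q\<in>I-{p}. x q * c \<omega> r q) =
          0 * c \<omega> r p + (\<Sum>q\<in>I-{p}. (\<lambda>q\<in>I-{p}. x q + t * a q) q * c \<omega> r q)"
        by (simp add: distrib_right sum.distrib)
    qed
    have "\<bar>u k p \<omega>\<bar> \<le> inverse (real (Suc k)) * A" for k
    proof -
      define t where "t = inverse (real (Suc k))"
      have "(\<lambda>x. f p (\<omega>, S p 0 \<omega> x)) \<in> borel_measurable (PiM (I - {p}) (\<lambda>_. borel))"
        using measurable_Pair2[OF fS_meas[OF p, of 0] \<omega>] by (simp add: measurable_cong_sets[OF sets_Q refl])
      from cube_shift[OF _ this, of "\<lambda>q. t * a q"] fin f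
      have "\<bar>F p t \<omega> - F p 0 \<omega>\<bar> \<le> 2 * (\<Sum>q\<in>I-{p}. \<bar>t * a q\<bar>)"
        unfolding F_def shift[of t] Q_def by simp
      also have "\<dots> = t * A"
        by (simp add: A_def abs_mult sum_distrib_left t_def mult_ac)
      finally show ?thesis by (simp add: u_def t_def abs_minus_commute)
    qed
    then show "eventually (\<lambda>k. norm \<bar>u k p \<omega>\<bar> \<le> inverse (real (Suc k)) * A) sequentially" by simp
    show "(\<lambda>k. inverse (real (Suc k)) * A) \<longlonglongrightarrow> 0"
      using tendsto_mult_left_zero[OF LIMSEQ_inverse_real_of_nat] .
  qed
  \<comment> \<open>Truncating from below at \<open>d\<close> turns the pointwise bound on the limes superior into convergence.\<close>
  define T where "T k \<omega> = max (real d) (\<Sum>p\<in>I. u k p \<omega>)" for k \<omega>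
  have T_lim: "(\<lambda>k. T k \<omega>) \<longlonglongrightarrow> real d" if \<omega>: "\<omega> \<in> space M" for \<omega>
  proof -
    \<comment> \<open>The exceptional positions for this \<open>\<omega>\<close>: at most
      \<open>d\<close> of them, each contributing at most 1, while the terms outside
      \<open>B\<close> tend to 0.\<close>
    define B where "B = {p \<in> I. \<not> (\<exists>a. \<forall>r<d. c \<omega> r p = (\<Sum>q\<in>I-{p}. a q * c \<omega> r q))}"
    have B: "card B \<le> d" "B \<subseteq> I"
      unfolding B_def using card_columns_not_in_span[OF fin] by auto
    have sum_B: "(\<Sum>p\<in>B. u k p \<omega>) \<le> real d" for k
    proof -
      have "(\<Sum>p\<in>B. u k p \<omega>) \<le> of_nat (card B) * 1" by (rule sum_bounded_above) (rule u1)
      with B show ?thesis by simp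
    qed
    have "(\<Sum>p\<in>I. u k p \<omega>) \<le> real d + \<bar>\<Sum>p\<in>I-B. u k p \<omega>\<bar>" for k
      using sum.subset_diff[OF B(2) fin, of "\<lambda>p. u k p \<omega>"] sum_B[of k]
        abs_ge_self[of "\<Sum>p\<in>I-B. u k p \<omega>"] by linarith
    then have upper: "T k \<omega> \<le> real d + \<bar>\<Sum>p\<in>I-B. u k p \<omega>\<bar>" for k
      by (simp add: T_def)
    have "(\<lambda>k. \<Sum>p\<in>I-B. u k p \<omega>) \<longlonglongrightarrow> (\<Sum>p\<in>I-B. 0)"
      by (intro tendsto_sum) (auto simp: B_def intro!: u_lim[OF _ \<omega>])
    from tendsto_add[OF tendsto_const tendsto_rabs[OF this], of "real d"]
    have "(\<lambda>k. real d + \<bar>\<Sum>p\<in>I-B. u k p \<omega>\<bar>) \<longlonglongrightarrow> real d" by simp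
    from tendsto_sandwich[OF _ _ tendsto_const this, of "\<lambda>k. T k \<omega>"] upper
    show ?thesis by (simp add: T_def)
  qed
  have u_meas [measurable]: "u k p \<in> borel_measurable M" if "p \<in> I" for k p
    unfolding u_def using F_meas[OF that] by measurable
  have T_meas [measurable]: "T k \<in> borel_measurable M" for k
    unfolding T_def by (intro borel_measurable_max borel_measurable_sum) auto
  have sum_u: "\<bar>\<Sum>p\<in>I. u k p \<omega>\<bar> \<le> card I" for k \<omega>
  proof -
    have "\<bar>\<Sum>p\<in>I. u k p \<omega>\<bar> \<le> (\<Sum>p\<in>I. \<bar>u k p \<omega>\<bar>)" by (rule sum_abs)
    also have "\<dots> \<le> of_nat (card I) * 1" by (rule sum_bounded_above) (use u1 in \<open>auto simp: abs_le_iff minus_le_iff\<close>)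
    finally show ?thesis by simp
  qed
  have T_bound: "norm (T k \<omega>) \<le> real d + card I" for k \<omega>
    using sum_u[of k \<omega>] unfolding T_def by auto
  have "(\<lambda>k. \<integral>\<omega>. T k \<omega> \<partial>M) \<longlonglongrightarrow> (\<integral>\<omega>. real d \<partial>M)"
    by (rule integral_dominated_convergence[where w = "\<lambda>_. real d + card I"])
       (use T_lim T_bound in auto)
  \<comment> \<open>At each position the expected drop is at least \<open>\<alpha> - \<beta>\<close>
    for every \<open>k\<close>, so the bound passes to the limit.\<close>
  moreover have "(\<alpha> - \<beta>) * card I \<le> (\<integral>\<omega>. T k \<omega> \<partial>M)" for k
  proof -
    have "(\<alpha> - \<beta>) * card I = (\<Sum>p\<in>I. \<alpha> - \<beta>)" by simp
    also have "\<dots> \<le> (\<Sum>p\<in>I. \<integral>\<omega>. u k p \<omega> \<partial>M)"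
      by (intro sum_mono)
         (use F0 Ft[of _ "inverse (real (Suc k))"] in \<open>auto simp: u_def F_int intro: diff_mono\<close>)
    also have "\<dots> = (\<integral>\<omega>. (\<Sum>p\<in>I. u k p \<omega>) \<partial>M)"
      by (rule Bochner_Integration.integral_sum[symmetric]) (simp add: u_def F_int)
    also have "\<dots> \<le> (\<integral>\<omega>. T k \<omega> \<partial>M)"
    proof (rule integral_mono)
      show "integrable M (\<lambda>\<omega>. \<Sum>p\<in>I. u k p \<omega>)" by (simp add: u_def F_int)
      show "integrable M (T k)"
        by (rule M.integrable_const_bound[where B = "real d + card I"]) (use T_bound in auto)
    qed (auto simp: T_def)
    finally show ?thesis .
  qed
  ultimately show ?thesis
    by (intro LIMSEQ_le_const[of _ "real d"]) (auto simp: M.prob_space)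
qed

section \<open>Semidefinite programs that isolate one matrix entry\<close>

definition sym_unit :: "nat \<Rightarrow> nat \<times> nat \<Rightarrow> rmat" where
  "sym_unit n p = mat n n (\<lambda>(k, l). of_bool ((k, l) = p) + of_bool ((l, k) = p))"

definition diag_unit :: "nat \<Rightarrow> nat \<Rightarrow> rmat" where
  "diag_unit n i = mat n n (\<lambda>(k, l). of_bool (k = i \<and> l = i))"

text \<open>For \<open>I\<close> strictly above the diagonal the two summands have disjoint
  supports: \<open>x\<close> gives the upper entries and the diagonal is zero.\<close>

definition hollow_mat :: "nat \<Rightarrow> (nat \<times> nat) set \<Rightarrow> (nat \<times> nat \<Rightarrow> real) \<Rightarrow> rmat" where
  "hollow_mat n I x = mat n n (\<lambda>(k, l). of_bool ((k, l) \<in> I) * x (k, l) + of_bool ((l, k) \<in> I) * x (l, k))"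

text \<open>As bounds on the diagonal of a positive semidefinite matrix, the zeros force it to
  vanish outside the block of rows and columns named by \<open>p\<close>.\<close>

definition entry_bounds :: "nat \<times> nat \<Rightarrow> nat \<Rightarrow> real" where
  "entry_bounds p k = of_bool (k = fst p \<or> k = snd p)"

lemma sym_unit_sym: "sym_unit n p \<in> sym_mats n"
  by (auto simp: sym_unit_def sym_mats_def intro!: eq_matI)

lemma diag_unit_sym: "diag_unit n i \<in> sym_mats n"
  by (auto simp: diag_unit_def sym_mats_def intro!: eq_matI)

lemma hollow_mat_sym: "hollow_mat n I x \<in> sym_mats n"
  by (auto simp: hollow_mat_def sym_mats_def intro!: eq_matI)

lemma sym_matsD: "X \<in> sym_mats n \<Longrightarrow> X \<in> carrier_mat n n"
  by (simp add: sym_mats_def)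

lemma sym_mats_entry: "X \<in> sym_mats n \<Longrightarrow> k < n \<Longrightarrow> l < n \<Longrightarrow> X $$ (k, l) = X $$ (l, k)"
  unfolding sym_mats_def by (metis (mono_tags, lifting) carrier_matD index_transpose_mat(1) mem_Collect_eq)

lemma mat_trace_mult:
  assumes "A \<in> carrier_mat n n" "X \<in> carrier_mat n n"
  shows "mat_trace (A * X) = (\<Sum>k<n. \<Sum>l<n. A $$ (k, l) * X $$ (l, k))"
  using assms by (auto simp: mat_trace_def scalar_prod_def lessThan_atLeast0 intro!: sum.cong)

lemma quadratic_form:
  fixes X :: rmat
  assumes "X \<in> carrier_mat n n" "v \<in> carrier_vec n"
  shows "scalar_prod v (X *\<^sub>v v) = (\<Sum>k<n. \<Sum>l<n. vec_index v k * X $$ (k, l) * vec_index v l)"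
  using assms
  by (auto simp: scalar_prod_def lessThan_atLeast0 sum_distrib_left mult_ac intro!: sum.cong)

text \<open>The quadratic form evaluated at e_a + s e_b.\<close>

lemma psd_two_entries:
  assumes X: "X \<in> psd_mats n" and "a < n" "b < n"
  shows "0 \<le> X $$ (a, a) + 2 * s * X $$ (a, b) + s\<^sup>2 * X $$ (b, b)"
proof -
  define v where "v = Matrix.vec n (\<lambda>k. of_bool (k = a) + s * of_bool (k = b))"
  have Xc: "X \<in> carrier_mat n n" and Xs: "X \<in> sym_mats n"
    using X by (auto simp: psd_mats_def sym_mats_def)
  have vc: "v \<in> carrier_vec n" by (simp add: v_def)
  have "0 \<le> scalar_prod v (X *\<^sub>v v)" using X vc by (auto simp: psd_mats_def)
  also have "\<dots> = (\<Sum>k<n. \<Sum>l<n. (of_bool (k = a) + s * of_bool (k = b)) * X $$ (k, l) *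
      (of_bool (l = a) + s * of_bool (l = b)))"
    unfolding quadratic_form[OF Xc vc] by (simp add: v_def)
  also have "\<dots> = (\<Sum>k<n. (of_bool (k = a) + s * of_bool (k = b)) * (X $$ (k, a) + s * X $$ (k, b)))"
  proof (intro sum.cong refl)
    fix k
    have "(\<Sum>l<n. X $$ (k, l) * (of_bool (l = a) + s * of_bool (l = b))) =
      (\<Sum>l<n. if l = a then X $$ (k, l) else 0) + (\<Sum>l<n. if l = b then s * X $$ (k, l) else 0)"
      unfolding sum.distrib[symmetric] by (intro sum.cong) (auto simp: algebra_simps)
    also have "\<dots> = X $$ (k, a) + s * X $$ (k, b)" using assms(2,3) by simp
    finally show "(\<Sum>l<n. (of_bool (k = a) + s * of_bool (k = b)) * X $$ (k, l) *
        (of_bool (l = a) + s * of_bool (l = b))) =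
        (of_bool (k = a) + s * of_bool (k = b)) * (X $$ (k, a) + s * X $$ (k, b))"
      by (simp add: mult.assoc flip: sum_distrib_left)
  qed
  also have "\<dots> = (\<Sum>k<n. if k = a then X $$ (k, a) + s * X $$ (k, b) else 0) +
      (\<Sum>k<n. if k = b then s * (X $$ (k, a) + s * X $$ (k, b)) else 0)"
    unfolding sum.distrib[symmetric] by (intro sum.cong) (auto simp: algebra_simps)
  also have "\<dots> = X $$ (a, a) + s * X $$ (a, b) + s * (X $$ (b, a) + s * X $$ (b, b))"
    using assms(2,3) by simp
  also have "X $$ (b, a) = X $$ (a, b)" using sym_mats_entry[OF Xs] assms(2,3) by simp
  finally show ?thesis by (simp add: algebra_simps power2_eq_square)
qed

text \<open>The form at e_a + s e_b is bounded above by an affine function of \<open>s\<close>,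
  which can be nonnegative for all \<open>s\<close> only if its slope is zero.\<close>

lemma psd_row_zero:
  assumes X: "X \<in> psd_mats n" and "a < n" "b < n" "X $$ (b, b) \<le> 0"
  shows "X $$ (a, b) = 0"
proof (rule ccontr)
  assume nz: "X $$ (a, b) \<noteq> 0"
  \<comment> \<open>Chosen so that the affine part equals \<open>- 1\<close>.\<close>
  define s where "s = - (X $$ (a, a) + 1) / (2 * X $$ (a, b))"
  have "0 \<le> X $$ (a, a) + 2 * s * X $$ (a, b) + s\<^sup>2 * X $$ (b, b)"
    by (rule psd_two_entries) (use assms in auto)
  also have "X $$ (a, a) + 2 * s * X $$ (a, b) = - 1" using nz by (simp add: s_def field_simps)
  also have "- 1 + s\<^sup>2 * X $$ (b, b) < 0"
    using assms(4) mult_nonneg_nonpos[of "s\<^sup>2" "X $$ (b, b)"] by simp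
  finally show False by simp
qed

lemma mat_trace_diag_unit:
  assumes "X \<in> carrier_mat n n" "i < n"
  shows "mat_trace (diag_unit n i * X) = X $$ (i, i)"
proof -
  have "mat_trace (diag_unit n i * X) = (\<Sum>k<n. \<Sum>l<n. diag_unit n i $$ (k, l) * X $$ (l, k))"
    by (rule mat_trace_mult) (use assms in \<open>auto simp: diag_unit_def\<close>)
  also have "\<dots> = (\<Sum>k<n. \<Sum>l<n. if l = i then (if k = i then X $$ (l, k) else 0) else 0)"
    by (intro sum.cong) (auto simp: diag_unit_def)
  also have "\<dots> = X $$ (i, i)" using assms(2) by simp
  finally show ?thesis .
qed

lemma mat_trace_hollow:
  assumes X: "X \<in> sym_mats n" and I: "I \<subseteq> {..<n} \<times> {..<n}"
  shows "mat_trace (hollow_mat n I x * X) = 2 * (\<Sum>p\<in>I. x p * X $$ p)"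
proof -
  have half: "(\<Sum>k<n. \<Sum>l<n. of_bool ((k, l) \<in> I) * x (k, l) * X $$ (k, l)) = (\<Sum>p\<in>I. x p * X $$ p)"
  proof -
    have "(\<Sum>k<n. \<Sum>l<n. of_bool ((k, l) \<in> I) * x (k, l) * X $$ (k, l)) =
        (\<Sum>p\<in>{..<n} \<times> {..<n}. if p \<in> I then x p * X $$ p else 0)"
      unfolding sum.cartesian_product by (intro sum.cong) auto
    also have "\<dots> = (\<Sum>p\<in>I. x p * X $$ p)"
      using I by (subst sum.inter_restrict[symmetric]) (auto simp: Int_absorb1)
    finally show ?thesis .
  qed
  have "mat_trace (hollow_mat n I x * X) = (\<Sum>k<n. \<Sum>l<n. hollow_mat n I x $$ (k, l) * X $$ (l, k))"
    by (rule mat_trace_mult) (use sym_matsD[OF X] in \<open>auto simp: hollow_mat_def\<close>)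
  also have "\<dots> = (\<Sum>k<n. \<Sum>l<n. of_bool ((k, l) \<in> I) * x (k, l) * X $$ (k, l) +
      of_bool ((l, k) \<in> I) * x (l, k) * X $$ (l, k))"
    using sym_mats_entry[OF X] by (intro sum.cong) (auto simp: hollow_mat_def algebra_simps)
  also have "\<dots> = (\<Sum>p\<in>I. x p * X $$ p) + (\<Sum>k<n. \<Sum>l<n. of_bool ((l, k) \<in> I) * x (l, k) * X $$ (l, k))"
    by (simp add: sum.distrib half)
  also have "(\<Sum>k<n. \<Sum>l<n. of_bool ((l, k) \<in> I) * x (l, k) * X $$ (l, k)) = (\<Sum>p\<in>I. x p * X $$ p)"
    by (subst sum.swap) (rule half)
  finally show ?thesis by simp
qed

text \<open>The zero bounds remove every position of \<open>I\<close> except \<open>p\<close> from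
  the objective, and the remaining entry of \<open>X\<close> is at most 1, with equality for the
  all-ones block.\<close>

lemma sdp_value_entry:
  assumes I: "I \<subseteq> {(k, l). k < l \<and> l < n}" and p: "p \<in> I" and x: "0 \<le> x p"
  shows "sdp_value n n (hollow_mat n I x) (diag_unit n) (entry_bounds p) = ereal (2 * x p)"
proof -
  obtain i j where ij: "p = (i, j)" "i < j" "j < n" using I p by auto
  have I': "I \<subseteq> {..<n} \<times> {..<n}" using I by auto
  then have fin: "finite I" by (rule finite_subset) auto
  \<comment> \<open>The outer product of e_i + e_j with itself, so its quadratic form is a
    square.\<close>
  define J where "J = mat n n (\<lambda>(k, l). of_bool (k = i \<or> k = j) * of_bool (l = i \<or> l = j) :: real)"
  have J_sym: "J \<in> sym_mats n" by (auto simp: J_def sym_mats_def intro!: eq_matI)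
  have J_psd: "J \<in> psd_mats n"
  proof -
    have "0 \<le> scalar_prod v (J *\<^sub>v v)" if "v \<in> carrier_vec n" for v
    proof -
      have "scalar_prod v (J *\<^sub>v v) =
          (\<Sum>k<n. \<Sum>l<n. (of_bool (k = i \<or> k = j) * vec_index v k) * (of_bool (l = i \<or> l = j) * vec_index v l))"
        unfolding quadratic_form[OF sym_matsD[OF J_sym] that]
        by (intro sum.cong) (auto simp: J_def)
      also have "\<dots> = (\<Sum>k<n. of_bool (k = i \<or> k = j) * vec_index v k)\<^sup>2"
        by (simp add: sum_product power2_eq_square)
      finally show ?thesis by simp
    qed
    with J_sym show ?thesis by (simp add: psd_mats_def)
  qed
  have "J \<in> sdp_feasible n n (diag_unit n) (entry_bounds p)"
    using J_psd sym_matsD[OF J_sym]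
    by (auto simp: sdp_feasible_def mat_trace_diag_unit ij entry_bounds_def J_def)
  moreover have "mat_trace (hollow_mat n I x * J) = 2 * x p"
  proof -
    have "(\<Sum>q\<in>I. x q * J $$ q) = (\<Sum>q\<in>I. if q = p then x q else 0)"
    proof (intro sum.cong refl)
      fix q assume "q \<in> I"
      then obtain k l where "q = (k, l)" "k < l" "l < n" using I by auto
      then show "x q * J $$ q = (if q = p then x q else 0)"
        using ij by (cases "q = p") (auto simp: J_def)
    qed
    then show ?thesis using p fin by (simp add: mat_trace_hollow[OF J_sym I'])
  qed
  moreover have "mat_trace (hollow_mat n I x * X) \<le> 2 * x p"
    if "X \<in> sdp_feasible n n (diag_unit n) (entry_bounds p)" for X
  proof -
    have X: "X \<in> psd_mats n" and "\<forall>k<n. mat_trace (diag_unit n k * X) \<le> entry_bounds p k"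
      using that by (auto simp: sdp_feasible_def)
    moreover have Xs: "X \<in> sym_mats n" using X by (simp add: psd_mats_def)
    ultimately have diag: "X $$ (k, k) \<le> entry_bounds p k" if "k < n" for k
      using that mat_trace_diag_unit[OF sym_matsD[OF Xs]] by simp
    have zero: "X $$ (k, l) = 0" if "(k, l) \<in> I" "(k, l) \<noteq> p" for k l
    proof -
      have kl: "k < l" "l < n" using I that(1) by auto
      \<comment> \<open>Since \<open>k < l\<close> and \<open>i < j\<close>, only \<open>p\<close>
        itself has both indices in \<open>{i, j}\<close>.\<close>
      then have "k \<notin> {i, j} \<or> l \<notin> {i, j}" using that(2) ij by auto
      then show ?thesis
      proof
        assume "l \<notin> {i, j}"
        then show ?thesis using psd_row_zero[OF X, of k l] diag[of l] kl ij by (simp add: entry_bounds_def)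
      next
        assume "k \<notin> {i, j}"
        then have "X $$ (l, k) = 0"
          using psd_row_zero[OF X, of l k] diag[of k] kl ij by (simp add: entry_bounds_def)
        then show ?thesis using sym_mats_entry[OF Xs, of k l] kl by simp
      qed
    qed
    have "(\<Sum>q\<in>I. x q * X $$ q) = (\<Sum>q\<in>I. if q = p then x q * X $$ q else 0)"
      using zero by (intro sum.cong) auto
    then have "mat_trace (hollow_mat n I x * X) = 2 * (x p * X $$ p)"
      using p fin by (simp add: mat_trace_hollow[OF Xs I'])
    \<comment> \<open>At \<open>s = - 1\<close> the form bounds twice this entry by the sum of two
      diagonal entries, each at most 1.\<close>
    moreover have "X $$ p \<le> 1"
      using psd_two_entries[OF X, of i j "- 1"] diag[of i] diag[of j] ij by (simp add: entry_bounds_def)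
    ultimately show ?thesis using x mult_left_le[of "X $$ p" "x p"] by simp
  qed
  ultimately show ?thesis
    unfolding sdp_value_def
    by (intro antisym SUP_least SUP_upper2[of J]) auto
qed

section \<open>Coordinates of the sketch and their measurability\<close>

text \<open>This gives the sketch the matrix-vector form of
  \<open>distinguishing_dimension_bound\<close>; the columns are the sketches of the
  \<open>sym_unit\<close> matrices.\<close>

lemma linear_mat_map_hollow:
  assumes L: "linear_mat_map n d L" and "finite I"
  shows "L (hollow_mat n I x) = Matrix.vec d (\<lambda>r. \<Sum>q\<in>I. x q * vec_index (L (sym_unit n q)) r)"
  using \<open>finite I\<close>
proof induction
  case empty
  \<comment> \<open>The matrix is zero; written as a multiple by 0 it has zero sketch by homogeneity
    of \<open>L\<close>.\<close>
  have zero: "hollow_mat n {} x = 0 \<cdot>\<^sub>m hollow_mat n {} x"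
    by (auto simp: hollow_mat_def intro!: eq_matI)
  have c: "hollow_mat n {} x \<in> carrier_mat n n" by (simp add: hollow_mat_def)
  with L have "L (hollow_mat n {} x) \<in> carrier_vec d" "L (hollow_mat n {} x) = 0 \<cdot>\<^sub>v L (hollow_mat n {} x)"
    by (auto simp: linear_mat_map_def simp flip: zero)
       (metis zero)
  then show ?case by (auto intro!: eq_vecI) (metis index_smult_vec(1) mult_zero_left carrier_vecD)
next
  case (insert q I)
  have eq: "hollow_mat n (insert q I) x = hollow_mat n I x + x q \<cdot>\<^sub>m sym_unit n q"
    using insert.hyps(2) by (intro eq_matI) (auto simp: hollow_mat_def sym_unit_def)
  have c: "hollow_mat n I x \<in> carrier_mat n n" "sym_unit n q \<in> carrier_mat n n"
    by (simp_all add: hollow_mat_def sym_unit_def)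
  then have "L (hollow_mat n (insert q I) x) = L (hollow_mat n I x) + x q \<cdot>\<^sub>v L (sym_unit n q)"
    using L by (simp add: eq linear_mat_map_def)
  moreover have "L (sym_unit n q) \<in> carrier_vec d" using L c by (auto simp: linear_mat_map_def)
  ultimately show ?case
    using insert.hyps by (intro eq_vecI) (auto simp: insert.IH add.commute)
qed

lemma measurable_borel_vec_index:
  "r < d \<Longrightarrow> (\<lambda>v. vec_index v r) \<in> borel_measurable (borel_vec d)"
proof -
  assume r: "r < d"
  have "(\<lambda>v. \<lambda>i\<in>{..<d}. vec_index v i) \<in> borel_vec d \<rightarrow>\<^sub>M PiM {..<d} (\<lambda>_. borel :: real measure)"
    unfolding borel_vec_def by (rule measurable_vimage_algebra1) (auto simp: space_PiM)
  from measurable_compose[OF this measurable_component_singleton[of r]] r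
  show ?thesis by simp
qed

text \<open>The test receives a sketch as a coordinate function, the algorithm as a vector; this is
  the passage between them.\<close>

lemma measurable_vec_borel_vec:
  "Matrix.vec d \<in> PiM {..<d} (\<lambda>_. borel :: real measure) \<rightarrow>\<^sub>M borel_vec d"
  unfolding borel_vec_def
proof (rule measurable_vimage_algebra2)
  have "(\<lambda>y. y) \<in> PiM {..<d} (\<lambda>_. borel :: real measure) \<rightarrow>\<^sub>M PiM {..<d} (\<lambda>_. borel)" by simp
  then show "(\<lambda>y. \<lambda>i\<in>{..<d}. vec_index (Matrix.vec d y) i)
      \<in> PiM {..<d} (\<lambda>_. borel :: real measure) \<rightarrow>\<^sub>M PiM {..<d} (\<lambda>_. borel)"
    by (rule measurable_cong[THEN iffD1, rotated])
       (auto simp: space_PiM PiE_def extensional_def fun_eq_iff)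
qed auto

text \<open>The multiplier is at least \<open>1 / \<tau>\<close>, hence positive.\<close>

lemma within_factor_zero_iff:
  assumes "within_factor \<tau> v x" "0 < \<tau>"
  shows "x = 0 \<longleftrightarrow> v = 0"
proof -
  obtain s where "1 / \<tau> \<le> s" "x = s * v" using assms(1) by (auto simp: within_factor_def)
  moreover have "0 < 1 / \<tau>" using assms(2) by simp
  ultimately show ?thesis by auto
qed

section \<open>From the sketching algorithm to tests for vanishing entries\<close>

text \<open>All SDPs used share \<open>n\<close> constraints with matrices \<open>diag_unit\<close>,
  so a single algorithm serves them all; the position \<open>p\<close> enters only through the
  bounds.\<close>

lemma sketch_dimension_bound:
  fixes \<tau> :: real and M :: "'w measure"
  assumes \<tau>: "0 < \<tau>" and \<Phi>: "random_linear_map M n d \<Phi>" and sk: "sketch_estimates_sdps M n d \<Phi> \<tau>"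
    and I: "I \<subseteq> {(k, l). k < l \<and> l < n}"
  shows "4 / 5 * card I \<le> d"
proof -
  from \<Phi> have "prob_space M" and lin: "\<And>\<omega>. \<omega> \<in> space M \<Longrightarrow> linear_mat_map n d (\<Phi> \<omega>)"
    and \<Phi>_meas: "\<And>X. X \<in> carrier_mat n n \<Longrightarrow> (\<lambda>\<omega>. \<Phi> \<omega> X) \<in> M \<rightarrow>\<^sub>M borel_vec d"
    by (auto simp: random_linear_map_def)
  interpret prob_space M by fact
  have "I \<subseteq> {..<n} \<times> {..<n}" using I by auto
  then have fin: "finite I" by (rule finite_subset) auto
  let ?G = "\<lambda>p. \<lambda>i\<in>{..<n}. entry_bounds p i"
  let ?B = "\<lambda>\<omega>. \<lambda>i\<in>{..<n}. \<Phi> \<omega> (diag_unit n i)"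
  obtain alg where
    alg_meas: "alg \<in> M \<Otimes>\<^sub>M (\<Pi>\<^sub>M i\<in>{..<n}. borel) \<Otimes>\<^sub>M borel_vec d \<Otimes>\<^sub>M (\<Pi>\<^sub>M i\<in>{..<n}. borel_vec d)
        \<rightarrow>\<^sub>M (borel :: real measure)" and
    alg: "\<And>A \<gamma> v. A \<in> sym_mats n \<Longrightarrow> sdp_value n n A (diag_unit n) \<gamma> = ereal v \<Longrightarrow>
      9 / 10 \<le> prob {\<omega> \<in> space M. within_factor \<tau> v (alg (\<omega>, (\<lambda>i\<in>{..<n}. \<gamma> i), \<Phi> \<omega> A, ?B \<omega>))}"
    using sk diag_unit_sym unfolding sketch_estimates_sdps_def by meson
  \<comment> \<open>The algorithm run on \<open>\<omega>\<close> and the coordinates of the sketch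
    of the objective: the bounds are constant for given \<open>p\<close>, and the constraint
    sketches are functions of \<open>\<omega>\<close>.\<close>
  define g where "g p z = alg (fst z, ?G p, Matrix.vec d (snd z), ?B (fst z))" for p z
  have g_meas: "g p \<in> borel_measurable (M \<Otimes>\<^sub>M PiM {..<d} (\<lambda>_. borel))" for p
    unfolding g_def
  proof (rule measurable_compose[OF _ alg_meas], intro measurable_Pair)
    show "(\<lambda>z. ?B (fst z)) \<in> M \<Otimes>\<^sub>M PiM {..<d} (\<lambda>_. borel) \<rightarrow>\<^sub>M (\<Pi>\<^sub>M i\<in>{..<n}. borel_vec d)"
      by (intro measurable_restrict measurable_compose[OF measurable_fst] \<Phi>_meas sym_matsD diag_unit_sym)
    show "(\<lambda>z. Matrix.vec d (snd z)) \<in> M \<Otimes>\<^sub>M PiM {..<d} (\<lambda>_. borel) \<rightarrow>\<^sub>M borel_vec d"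
      by (rule measurable_compose[OF measurable_snd measurable_vec_borel_vec])
    show "(\<lambda>z. ?G p) \<in> M \<Otimes>\<^sub>M PiM {..<d} (\<lambda>_. borel) \<rightarrow>\<^sub>M (\<Pi>\<^sub>M i\<in>{..<n}. borel)"
      by (intro measurable_const) (auto simp: space_PiM)
  qed simp
  define c where "c \<omega> r q = vec_index (\<Phi> \<omega> (sym_unit n q)) r" for \<omega> r q
  have c_meas: "(\<lambda>\<omega>. c \<omega> r q) \<in> borel_measurable M" if "r < d" for r q
    unfolding c_def
    by (rule measurable_compose[OF \<Phi>_meas measurable_borel_vec_index[OF that]])
       (rule sym_matsD[OF sym_unit_sym])
  let ?y = "\<lambda>x \<omega>. \<lambda>r\<in>{..<d}. \<Sum>q\<in>I. x q * c \<omega> r q"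
  have y_meas: "?y x \<in> M \<rightarrow>\<^sub>M PiM {..<d} (\<lambda>_. borel)" for x
    by (intro measurable_restrict borel_measurable_sum borel_measurable_times borel_measurable_const c_meas) simp
  have gy_meas [measurable]: "(\<lambda>\<omega>. g p (\<omega>, ?y x \<omega>)) \<in> borel_measurable M" for p x
    by (rule measurable_compose[OF _ g_meas], intro measurable_Pair y_meas) simp
  have success: "9 / 10 \<le> prob {\<omega> \<in> space M. g p (\<omega>, ?y x \<omega>) = 0 \<longleftrightarrow> x p = 0}"
    if p: "p \<in> I" "0 \<le> x p" for p x
  proof -
    have \<Phi>_hollow: "\<Phi> \<omega> (hollow_mat n I x) = Matrix.vec d (?y x \<omega>)" if "\<omega> \<in> space M" for \<omega>
      unfolding linear_mat_map_hollow[OF lin[OF that] fin] by (auto simp: c_def)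
    have "9 / 10 \<le> prob {\<omega> \<in> space M. within_factor \<tau> (2 * x p)
        (alg (\<omega>, ?G p, \<Phi> \<omega> (hollow_mat n I x), ?B \<omega>))}"
      by (rule alg[OF hollow_mat_sym sdp_value_entry[where p = p and x = x, OF I p]])
    also have "\<dots> \<le> prob {\<omega> \<in> space M. g p (\<omega>, ?y x \<omega>) = 0 \<longleftrightarrow> x p = 0}"
    proof (rule finite_measure_mono)
      show "{\<omega> \<in> space M. within_factor \<tau> (2 * x p) (alg (\<omega>, ?G p, \<Phi> \<omega> (hollow_mat n I x), ?B \<omega>))}
          \<subseteq> {\<omega> \<in> space M. g p (\<omega>, ?y x \<omega>) = 0 \<longleftrightarrow> x p = 0}"
        by (auto simp: \<Phi>_hollow g_def dest: within_factor_zero_iff[OF _ \<tau>])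
    qed measurable
    finally show ?thesis .
  qed
  have int_eq: "(\<integral>\<omega>. indicat_real {0} (g p (\<omega>, ?y x \<omega>)) \<partial>M) = prob {\<omega> \<in> space M. g p (\<omega>, ?y x \<omega>) = 0}" for p x
  proof -
    have "(\<integral>\<omega>. indicat_real {0} (g p (\<omega>, ?y x \<omega>)) \<partial>M) =
        (\<integral>\<omega>. indicator {\<omega> \<in> space M. g p (\<omega>, ?y x \<omega>) = 0} \<omega> \<partial>M :: real)"
      by (intro Bochner_Integration.integral_cong) (auto simp: indicator_def)
    then show ?thesis by simp
  qed
  \<comment> \<open>The test accepts when the estimate is 0: with probability at least 9/10 for a
    zero entry, and at most 1/10 for a positive one, by passing to the complement.\<close>
  have "(9 / 10 - 1 / 10) * card I \<le> d"
  proof (rule distinguishing_dimension_bound[OF \<open>prob_space M\<close> fin,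
      where c = c and f = "\<lambda>p z. indicat_real {0} (g p z)"])
    show "(\<lambda>z. indicat_real {0} (g p z)) \<in> borel_measurable (M \<Otimes>\<^sub>M PiM {..<d} (\<lambda>_. borel))" for p
      by (rule measurable_compose[OF g_meas]) simp
    show "9 / 10 \<le> (\<integral>\<omega>. indicat_real {0} (g p (\<omega>, ?y x \<omega>)) \<partial>M)" if "p \<in> I" "x p = 0" for p x
      unfolding int_eq using success[of p x] that by simp
    show "(\<integral>\<omega>. indicat_real {0} (g p (\<omega>, ?y x \<omega>)) \<partial>M) \<le> 1 / 10" if "p \<in> I" "0 < x p" for p x
    proof -
      have "prob {\<omega> \<in> space M. \<not> g p (\<omega>, ?y x \<omega>) = 0} = 1 - prob {\<omega> \<in> space M. g p (\<omega>, ?y x \<omega>) = 0}"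
        by (rule prob_neg) measurable
      with success[of p x] that show ?thesis unfolding int_eq by simp
    qed
  qed (auto simp: c_meas)
  then show ?thesis by simp
qed

theorem theorem5p1:
  fixes \<tau> :: real
  assumes "1 \<le> \<tau>" and "\<tau> < 2 / sqrt 3"
  shows "\<exists>c::real. c > 0 \<and>
    (\<forall>\<^sub>F D :: nat in sequentially.
       \<forall>(d :: nat) (M :: 'w measure) \<Phi>.
         random_linear_map M (2 * D) d \<Phi> \<longrightarrow>
         sketch_estimates_sdps M (2 * D) d \<Phi> \<tau> \<longrightarrow>
         c * (real D)^2 \<le> real d)"
proof (intro exI[of _ "4 / 5"] conjI always_eventually allI impI)
  fix D d :: nat and M :: "'w measure" and \<Phi>
  assume \<Phi>: "random_linear_map M (2 * D) d \<Phi>" "sketch_estimates_sdps M (2 * D) d \<Phi> \<tau>"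
  \<comment> \<open>The upper right block lies strictly above the diagonal and has
    \<open>D * D\<close> positions.\<close>
  have "4 / 5 * card ({..<D} \<times> {D..<2*D}) \<le> d"
    by (rule sketch_dimension_bound[OF _ \<Phi>]) (use assms(1) in auto)
  then show "4 / 5 * (real D)\<^sup>2 \<le> d" by (simp add: power2_eq_square)
qed simp

end
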